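(* Let $P=(X,\prec)$ be an interval order and define $f:X\to\{0,1\}$ by $f(x)=0$ when $x$ is co-simplicial in $P$ and $f(x)=1$ otherwise. The following are equivalent. (1) $P$ has a $\{0,1\}$-interval representation. (2) For every $\mathbf{3+1}$ induced in $P$, the middle element of the chain is co-simplicial. (3) The weighted digraph $G(P,f)$ has no negative cycles. (4) Every cycle in the weighted digraph $G'(P,f)$ with at least one $(-)$ arc has positive weight. (5) $P$ does not contain any induced poset from the set $\mathcal{H}$.
   Context: A poset $P=(X,\prec)$ is a finite set $X$ of points with an irreflexive, transitive relation $\prec$. Write $x\parallel y$ if $x,y$ are incomparable (distinct points with neither $x\prec y$ nor $y\prec x$), and $Inc(x)$ for the set of points incomparable to $x$. An interval representation of $P$ assigns to each $v\in X$ a closed real interval $I_v$ (possibly a single point) so that $x\prec y$ if and only if $I_x$ is completely to the left of $I_y$. A poset with an interval representation is an interval order. $|I_v|$ denotes the length of $I_v$. A $\{0,1\}$-interval representation is an interval representation in which every interval has length either 0 or 1. A point $x$ of a poset is co-simplicial if $Inc(x)$ is an antichain (a set of pairwise incomparable points). The poset $\mathbf{3+1}$ has four elements $a,b,c,x$ with $a\prec b\prec c$ and $x$ incomparable to each of $a,b,c$; $b$ is the middle element of its chain. A poset is induced in $P$ if it is isomorphic to the restriction of $\prec$ to some subset of $X$. Weighted digraphs: fix $\epsilon$ with $0<\epsilon<1/|X|^2$. For $f:X\to[0,\infty)$, $G(P,f)$ is the weighted digraph with vertex set $X$ and the following arcs: for all $a,b\in X$ with $a\succ b$, the arc $(a,b)$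 with weight $-f(b)-\epsilon$ (called a $(-)$ arc, even if $f(b)=0$); for all distinct $a,b\in X$ with $a\parallel b$, the arc $(a,b)$ with weight $f(a)$ and the arc $(b,a)$ with weight $f(b)$ (called $(+)$ arcs, even if the weight is 0). $G'(P,f)$ is identical except that for $a\succ b$ the $(-)$ arc $(a,b)$ has weight $-f(b)$. A cycle is a sequence of distinct vertices $x_1,\dots,x_t$ such that $(x_i,x_{i+1})$ is an arc for $1\le i\le t-1$ and $(x_t,x_1)$ is an arc; its weight is the sum of the weights of its arcs; a negative cycle is a cycle of negative weight. The set $\mathcal{H}$ consists of four posets on the six points $a,b,c,d,e,x$. In each of them $a\prec b\prec c$, $d\prec e$, $a\prec e$, $d\prec c$. The four posets are obtained by choosing independently whether $a\prec d$ or $a\parallel d$, and whether $e\prec c$ or $e\parallel c$. All remaining pairs are incomparable; in particular $x$ is incomparable to every other point, and $b$ is incomparable to $d$, $e$ and $x$. *)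

theory Defs
  imports Complex_Main "HOL-Library.Interval"
begin

section \<open>Finite posets\<close>

text \<open>A poset is given by a set of points and a strict order; values of the relation outside the
  set of points are irrelevant, so every notion below is relativised to that set.\<close>

definition finite_poset :: "'a set \<Rightarrow> ('a \<Rightarrow> 'a \<Rightarrow> bool) \<Rightarrow> bool" where
  "finite_poset X lt \<longleftrightarrow> finite X \<and> irreflp_on X lt \<and> transp_on X lt"

definition incomp :: "('a \<Rightarrow> 'a \<Rightarrow> bool) \<Rightarrow> 'a \<Rightarrow> 'a \<Rightarrow> bool" where
  "incomp lt x y \<longleftrightarrow> x \<noteq> y \<and> \<not> lt x y \<and> \<not> lt y x"

definition Inc :: "'a set \<Rightarrow> ('a \<Rightarrow> 'a \<Rightarrow> bool) \<Rightarrow> 'a \<Rightarrow> 'a set" where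
  "Inc X lt x = {y \<in> X. incomp lt x y}"

definition antichain :: "('a \<Rightarrow> 'a \<Rightarrow> bool) \<Rightarrow> 'a set \<Rightarrow> bool" where
  "antichain lt A \<longleftrightarrow> pairwise (incomp lt) A"

definition cosimplicial :: "'a set \<Rightarrow> ('a \<Rightarrow> 'a \<Rightarrow> bool) \<Rightarrow> 'a \<Rightarrow> bool" where
  "cosimplicial X lt x \<longleftrightarrow> antichain lt (Inc X lt x)"

definition poset_iso ::
  "('b \<Rightarrow> 'a) \<Rightarrow> 'b set \<Rightarrow> ('b \<Rightarrow> 'b \<Rightarrow> bool) \<Rightarrow> 'a set \<Rightarrow> ('a \<Rightarrow> 'a \<Rightarrow> bool) \<Rightarrow> bool" where
  "poset_iso \<phi> Y ltY S lt \<longleftrightarrow>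
     bij_betw \<phi> Y S \<and> (\<forall>u\<in>Y. \<forall>v\<in>Y. ltY u v \<longleftrightarrow> lt (\<phi> u) (\<phi> v))"

text \<open>The map \<open>\<phi>\<close> exhibits the poset on \<open>Y\<close> as the restriction of \<open>lt\<close> to a subset of \<open>X\<close>.\<close>

definition induced_via ::
  "('b \<Rightarrow> 'a) \<Rightarrow> 'b set \<Rightarrow> ('b \<Rightarrow> 'b \<Rightarrow> bool) \<Rightarrow> 'a set \<Rightarrow> ('a \<Rightarrow> 'a \<Rightarrow> bool) \<Rightarrow> bool" where
  "induced_via \<phi> Y ltY X lt \<longleftrightarrow> (\<exists>S. S \<subseteq> X \<and> poset_iso \<phi> Y ltY S lt)"

definition induced_in ::
  "'b set \<Rightarrow> ('b \<Rightarrow> 'b \<Rightarrow> bool) \<Rightarrow> 'a set \<Rightarrow> ('a \<Rightarrow> 'a \<Rightarrow> bool) \<Rightarrow> bool" where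
  "induced_in Y ltY X lt \<longleftrightarrow> (\<exists>\<phi>. induced_via \<phi> Y ltY X lt)"


section \<open>Interval representations\<close>

text \<open>The library type \<open>real interval\<close> consists of the nonempty closed bounded real intervals,
  including single points. Its order is inclusion, hence the separate relation below.\<close>

definition left_of :: "real interval \<Rightarrow> real interval \<Rightarrow> bool" where
  "left_of I J \<longleftrightarrow> (\<forall>s\<in>set_of I. \<forall>t\<in>set_of J. s < t)"

definition interval_rep :: "'a set \<Rightarrow> ('a \<Rightarrow> 'a \<Rightarrow> bool) \<Rightarrow> ('a \<Rightarrow> real interval) \<Rightarrow> bool" where
  "interval_rep X lt I \<longleftrightarrow> (\<forall>x\<in>X. \<forall>y\<in>X. lt x y \<longleftrightarrow> left_of (I x) (I y))"

definition interval_order :: "'a set \<Rightarrow> ('a \<Rightarrow> 'a \<Rightarrow> bool) \<Rightarrow> bool" where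
  "interval_order X lt \<longleftrightarrow> finite_poset X lt \<and> (\<exists>I. interval_rep X lt I)"

definition zero_one_interval_rep ::
  "'a set \<Rightarrow> ('a \<Rightarrow> 'a \<Rightarrow> bool) \<Rightarrow> ('a \<Rightarrow> real interval) \<Rightarrow> bool" where
  "zero_one_interval_rep X lt I \<longleftrightarrow>
     interval_rep X lt I \<and> (\<forall>x\<in>X. width (I x) = 0 \<or> width (I x) = 1)"


section \<open>The posets 3+1 and \<open>\<H>\<close>\<close>

datatype label = La | Lb | Lc | Ld | Le | Lx

definition three_plus_one_points :: "label set" where
  "three_plus_one_points = {La, Lb, Lc, Lx}"

definition three_plus_one_less :: "label \<Rightarrow> label \<Rightarrow> bool" where
  "three_plus_one_less u v \<longleftrightarrow> (u, v) \<in> {(La, Lb), (Lb, Lc), (La, Lc)}"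

text \<open>The flag \<open>p\<close> decides whether \<open>a \<prec> d\<close> or \<open>a \<parallel> d\<close>, and \<open>q\<close> whether \<open>e \<prec> c\<close> or \<open>e \<parallel> c\<close>.\<close>

definition H_less :: "bool \<Rightarrow> bool \<Rightarrow> label \<Rightarrow> label \<Rightarrow> bool" where
  "H_less p q u v \<longleftrightarrow>
     (u, v) \<in> {(La, Lb), (Lb, Lc), (La, Lc), (Ld, Le), (La, Le), (Ld, Lc)}
     \<or> p \<and> (u, v) = (La, Ld)
     \<or> q \<and> (u, v) = (Le, Lc)"

definition H_posets :: "(label set \<times> (label \<Rightarrow> label \<Rightarrow> bool)) set" where
  "H_posets = {(UNIV, H_less p q) | p q. True}"


section \<open>Weighted digraphs\<close>

text \<open>Each ordered pair carries at most one arc, so arcs are pairs of vertices; the two arc sets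
  record the sign attached to an arc, which is independent of the value of its weight.\<close>

record 'a wdigraph =
  verts :: "'a set"
  minus_arcs :: "('a \<times> 'a) set"
  plus_arcs :: "('a \<times> 'a) set"
  weight :: "'a \<times> 'a \<Rightarrow> real"

definition arcs :: "'a wdigraph \<Rightarrow> ('a \<times> 'a) set" where
  "arcs D = minus_arcs D \<union> plus_arcs D"

definition G :: "real \<Rightarrow> 'a set \<Rightarrow> ('a \<Rightarrow> 'a \<Rightarrow> bool) \<Rightarrow> ('a \<Rightarrow> real) \<Rightarrow> 'a wdigraph" where
  "G \<epsilon> X lt f =
     \<lparr>verts = X,
      minus_arcs = {(a, b). a \<in> X \<and> b \<in> X \<and> lt b a},
      plus_arcs = {(a, b). a \<in> X \<and> b \<in> X \<and> incomp lt a b},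
      weight = (\<lambda>(a, b). if lt b a then - f b - \<epsilon> else f a)\<rparr>"

definition G' :: "'a set \<Rightarrow> ('a \<Rightarrow> 'a \<Rightarrow> bool) \<Rightarrow> ('a \<Rightarrow> real) \<Rightarrow> 'a wdigraph" where
  "G' X lt f =
     \<lparr>verts = X,
      minus_arcs = {(a, b). a \<in> X \<and> b \<in> X \<and> lt b a},
      plus_arcs = {(a, b). a \<in> X \<and> b \<in> X \<and> incomp lt a b},
      weight = (\<lambda>(a, b). if lt b a then - f b else f a)\<rparr>"

text \<open>For \<open>xs = [x\<^sub>1, \<dots>, x\<^sub>t]\<close> this is \<open>[(x\<^sub>1, x\<^sub>2), \<dots>, (x\<^sub>t\<^sub>-\<^sub>1, x\<^sub>t), (x\<^sub>t, x\<^sub>1)]\<close>.\<close>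

definition cycle_arcs :: "'a list \<Rightarrow> ('a \<times> 'a) list" where
  "cycle_arcs xs = zip xs (rotate1 xs)"

definition is_cycle :: "'a wdigraph \<Rightarrow> 'a list \<Rightarrow> bool" where
  "is_cycle D xs \<longleftrightarrow>
     xs \<noteq> [] \<and> distinct xs \<and> set xs \<subseteq> verts D \<and> set (cycle_arcs xs) \<subseteq> arcs D"

definition cycle_weight :: "'a wdigraph \<Rightarrow> 'a list \<Rightarrow> real" where
  "cycle_weight D xs = (\<Sum>e\<leftarrow>cycle_arcs xs. weight D e)"

definition negative_cycle :: "'a wdigraph \<Rightarrow> 'a list \<Rightarrow> bool" where
  "negative_cycle D xs \<longleftrightarrow> is_cycle D xs \<and> cycle_weight D xs < 0"

end

theory Submission
  imports Defs
begin

text \<open>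
  Read an arc \<open>(a, b)\<close> of weight \<open>w\<close> as the constraint \<open>p b \<le> p a + w\<close> on the left endpoints \<open>p\<close> of
  intervals with lengths \<open>f\<close>. In \<open>G(P, f)\<close> the \<open>(-)\<close> arcs then say that \<open>b \<prec> a\<close> forces \<open>I\<^sub>b\<close> to end at
  least \<open>\<epsilon>\<close> before \<open>I\<^sub>a\<close> begins, and the \<open>(+)\<close> arcs that incomparable points have intersecting
  intervals. Solutions of such a system of difference constraints exist as soon as there is no
  negative cycle: take shortest-path distances (\<open>no_negative_cycle_potential\<close>). Hence absence
  of negative cycles in \<open>G(P, f)\<close> yields a \<open>{0,1}\<close>-representation.

  Conversely, in a \<open>{0,1}\<close>-representation the interval of the middle element of a \<open>3+1\<close> lies strictly
  inside a unit interval, so it is a single point. All intervals meeting it contain that point, and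
  the middle element is co-simplicial.

  The heart of the matter is that co-simplicial middles of all \<open>3+1\<close> imply positive weight in \<open>G'(P, f)\<close>
  of all cycles with a \<open>(-)\<close> arc. Consider a shortest closed walk with a \<open>(-)\<close> arc and without positive
  weight, and in it a \<open>(-)\<close> arc \<open>(b, c)\<close> followed by a \<open>(+)\<close> arc \<open>(c, d)\<close>, called a turn below. The two weights
  cancel, so any arc from \<open>b\<close> to \<open>d\<close> of weight at most 0 would be a shortcut. Excluding shortcuts yields
  \<open>b \<parallel> d\<close> and \<open>f b = f d = 1\<close> (\<open>turn_incomparable\<close>). Also the arc leaving \<open>d\<close> is a \<open>(+)\<close> arc, since otherwise
  absence of an induced \<open>2+2\<close> gives a shortcut (\<open>turn_next\<close>), and so is the arc entering \<open>b\<close>, since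
  otherwise there is a shortcut or \<open>b\<close> is the middle of a \<open>3+1\<close> (\<open>turn_prev\<close>). Therefore \<open>(-)\<close> arcs are
  isolated. Now collect the total weight by vertices: \<open>v\<close> receives \<open>f v\<close> if the walk leaves it by a
  \<open>(+)\<close> arc and \<open>- f v\<close> if the walk enters it by a \<open>(-)\<close> arc. Every contribution is nonnegative, and the
  vertex \<open>d\<close> of a turn contributes 1, so the weight is positive after all
  (\<open>no_minimal_nonpositive_walk\<close>).

  Since \<open>f\<close> is integral, positive weight in \<open>G'(P, f)\<close> means weight at least 1, and the at most \<open>|X|\<close>
  terms \<open>\<epsilon>\<close> lost in passing to \<open>G(P, f)\<close> do not consume it, so there are no negative cycles. Finally,
  the condition on \<open>3+1\<close> and the exclusion of \<open>\<H>\<close> are the same: two comparable points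
  \<open>d \<prec> e\<close> in \<open>Inc(b)\<close>, for \<open>b\<close> the middle of a \<open>3+1\<close>, have all their relations to the \<open>3+1\<close> determined by transitivity and the absence of \<open>2+2\<close>, except for the two
  that distinguish the members of \<open>\<H>\<close> (\<open>middles_cosimplicial_iff_H_free\<close>).
\<close>

section \<open>Closed walks\<close>

text \<open>Unlike a cycle, a closed walk may repeat vertices. Replacing a few consecutive arcs by one arc
  thus never leaves the class, and no shortcut below requires a distinctness check.\<close>

definition closed_walk :: "'a wdigraph \<Rightarrow> 'a list \<Rightarrow> bool" where
  "closed_walk D xs \<longleftrightarrow> xs \<noteq> [] \<and> set (cycle_arcs xs) \<subseteq> arcs D"

lemma cycle_arcs_Cons: "cycle_arcs (a # xs) = zip (a # xs) (xs @ [a])"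
  by (simp add: cycle_arcs_def)

lemma length_cycle_arcs [simp]: "length (cycle_arcs xs) = length xs"
  by (simp add: cycle_arcs_def)

lemma nth_cycle_arcs:
  "i < length xs \<Longrightarrow> cycle_arcs xs ! i = (xs ! i, xs ! (Suc i mod length xs))"
  by (simp add: cycle_arcs_def nth_rotate1)

lemma cycle_arcs_rotate: "cycle_arcs (rotate k xs) = rotate k (cycle_arcs xs)"
proof (rule nth_equalityI)
  fix i assume "i < length (cycle_arcs (rotate k xs))"
  then have i: "i < length xs" by simp
  then have "0 < length xs" by linarith
  then have "Suc i mod length xs < length xs" "(k + i) mod length xs < length xs" by simp_all
  with i show "cycle_arcs (rotate k xs) ! i = rotate k (cycle_arcs xs) ! i"
    by (simp add: nth_cycle_arcs nth_rotate mod_simps)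
qed simp

lemma set_cycle_arcs_rotate: "set (cycle_arcs (rotate k xs)) = set (cycle_arcs xs)"
  by (simp add: cycle_arcs_rotate)

lemma sum_list_rotate: "sum_list (rotate k xs) = (sum_list xs :: 'b :: comm_monoid_add)"
proof (induction k)
  case (Suc k)
  then show ?case by (cases "rotate k xs") (simp_all add: add.commute)
qed simp

lemma cycle_weight_rotate: "cycle_weight D (rotate k xs) = cycle_weight D xs"
  by (simp add: cycle_weight_def cycle_arcs_rotate rotate_map[symmetric] sum_list_rotate)

lemma closed_walk_rotate: "closed_walk D (rotate k xs) \<longleftrightarrow> closed_walk D xs"
  by (simp add: closed_walk_def set_cycle_arcs_rotate)

lemma cycle_weight_sum:
  "cycle_weight D xs = (\<Sum>i<length xs. weight D (xs ! i, xs ! (Suc i mod length xs)))"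
  by (simp add: cycle_weight_def sum_list_sum_nth nth_cycle_arcs atLeast0LessThan)

lemma sum_periodic_shift:
  fixes g :: "nat \<Rightarrow> 'b :: cancel_comm_monoid_add"
  assumes "g n = g 0"
  shows "(\<Sum>i<n. g (Suc i)) = (\<Sum>i<n. g i)"
  using sum.lessThan_Suc_shift[of g n] assms by (simp add: add.commute)


section \<open>Potentials\<close>

definition walk_weight :: "'a wdigraph \<Rightarrow> 'a list \<Rightarrow> real" where
  "walk_weight D p = (\<Sum>e\<leftarrow>zip p (tl p). weight D e)"

lemma zip_tl_append:
  "zip (p @ v # s) (tl (p @ v # s)) = zip (p @ [v]) (tl (p @ [v])) @ zip (v # s) s"
proof (induction p)
  case (Cons a p)
  then show ?case by (cases p) auto
qed simp

text \<open>The potential of \<open>v\<close> is the least weight of a simple walk ending in \<open>v\<close>, from any start. Appending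
  an arc \<open>(a, b)\<close> to an optimal walk for \<open>a\<close> either keeps it simple or closes a cycle through \<open>b\<close>; cutting
  off that cycle does not increase the weight and leaves a simple walk ending in \<open>b\<close>.\<close>

theorem no_negative_cycle_potential:
  assumes fin: "finite (verts D)" and sub: "arcs D \<subseteq> verts D \<times> verts D"
    and nonneg: "\<nexists>xs. negative_cycle D xs"
  shows "\<exists>p. \<forall>(a, b)\<in>arcs D. p b \<le> p a + weight D (a, b)"
proof -
  define S where "S v = {p. p \<noteq> [] \<and> distinct p \<and> set p \<subseteq> verts D
      \<and> set (zip p (tl p)) \<subseteq> arcs D \<and> last p = v}" for v
  define pot where "pot v = Min (walk_weight D ` S v)" for v
  have "S v \<subseteq> {p. set p \<subseteq> verts D \<and> length p \<le> card (verts D)}" for v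
  proof
    fix p assume "p \<in> S v"
    then have "distinct p" "set p \<subseteq> verts D" by (simp_all add: S_def)
    then show "p \<in> {p. set p \<subseteq> verts D \<and> length p \<le> card (verts D)}"
      using card_mono[OF fin, of "set p"] by (simp add: distinct_card)
  qed
  then have finS: "finite (S v)" for v
    using finite_lists_length_le[OF fin] finite_subset by blast
  have le: "pot v \<le> walk_weight D p" if "p \<in> S v" for p v
    unfolding pot_def using that finS by simp
  have "pot b \<le> pot a + weight D (a, b)" if ab: "(a, b) \<in> arcs D" for a b
  proof -
    have aV: "a \<in> verts D" and bV: "b \<in> verts D" using ab sub by auto
    have "[a] \<in> S a" using aV by (simp add: S_def)
    then have "pot a \<in> walk_weight D ` S a"
      unfolding pot_def using finS by (intro Min_in) auto
    then obtain p where p: "p \<in> S a" and pa: "pot a = walk_weight D p" by auto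
    have "p \<noteq> []" "last p = a" using p by (simp_all add: S_def)
    then obtain p' where p': "p = p' @ [a]" by (cases p rule: rev_cases) auto
    show ?thesis
    proof (cases "b \<in> set p")
      case False
      have "zip (p @ [b]) (tl (p @ [b])) = zip p (tl p) @ [(a, b)]"
        using zip_tl_append[of p' a "[b]"] p' by simp
      then have "p @ [b] \<in> S b" "walk_weight D (p @ [b]) = walk_weight D p + weight D (a, b)"
        using p False ab bV by (auto simp: S_def walk_weight_def)
      then show ?thesis using le pa by metis
    next
      case True
      then obtain q s where qs: "p = q @ b # s" by (meson split_list)
      have z: "zip p (tl p) = zip (q @ [b]) (tl (q @ [b])) @ zip (b # s) s"
        unfolding qs by (rule zip_tl_append)
      have "last (b # s) = a" using qs p' by (metis last_appendR last_snoc list.distinct(1))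
      then have c: "cycle_arcs (b # s) = zip (b # s) s @ [(a, b)]"
      proof (cases s rule: rev_cases)
        case (snoc s' y)
        with \<open>last (b # s) = a\<close> have "y = a" by simp
        then show ?thesis using snoc zip_append1[of "b # s'" "[a]" "s' @ [a, b]"]
          zip_append1[of "b # s'" "[a]" "s' @ [a]"] by (simp add: cycle_arcs_Cons)
      qed (simp add: cycle_arcs_Cons)
      have "is_cycle D (b # s)"
        using p ab z unfolding is_cycle_def c S_def by (simp add: qs)
      then have "0 \<le> cycle_weight D (b # s)"
        using nonneg by (meson negative_cycle_def not_le)
      then have "0 \<le> (\<Sum>e\<leftarrow>zip (b # s) s. weight D e) + weight D (a, b)"
        unfolding cycle_weight_def c by simp
      moreover have "walk_weight D p
          = walk_weight D (q @ [b]) + (\<Sum>e\<leftarrow>zip (b # s) s. weight D e)"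
        unfolding walk_weight_def z by simp
      moreover have "q @ [b] \<in> S b"
        using p z unfolding S_def by (simp add: qs)
      ultimately show ?thesis using le[of "q @ [b]" b] pa by simp
    qed
  qed
  then show ?thesis by blast
qed


section \<open>Interval orders and induced posets\<close>

lemma left_of_iff: "left_of I J \<longleftrightarrow> upper I < lower J"
proof
  assume "left_of I J"
  moreover have "upper I \<in> set_of I" "lower J \<in> set_of J" by (simp_all add: set_of_eq)
  ultimately show "upper I < lower J" unfolding left_of_def by blast
next
  assume "upper I < lower J"
  then show "left_of I J" by (auto simp: left_of_def set_of_eq)
qed

text \<open>The interval, of those of \<open>a\<close> and \<open>c\<close>, that ends first lies left of both \<open>I\<^sub>b\<close> and \<open>I\<^sub>d\<close>.\<close>

lemma interval_order_two_plus_two_free: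
  assumes "interval_order X lt" "a \<in> X" "b \<in> X" "c \<in> X" "d \<in> X" "lt a b" "lt c d"
  shows "lt a d \<or> lt c b"
proof -
  obtain I where "interval_rep X lt I" using assms(1) by (auto simp: interval_order_def)
  then have l: "lt x y \<longleftrightarrow> upper (I x) < lower (I y)" if "x \<in> X" "y \<in> X" for x y
    using that by (simp add: interval_rep_def left_of_iff)
  have "upper (I a) < lower (I b)" "upper (I c) < lower (I d)" using l assms by blast+
  then have "upper (I a) < lower (I d) \<or> upper (I c) < lower (I b)" by linarith
  then show ?thesis using l assms by blast
qed

lemma induced_via_iff:
  "induced_via \<phi> Y ltY X lt \<longleftrightarrow>
     inj_on \<phi> Y \<and> \<phi> ` Y \<subseteq> X \<and> (\<forall>u\<in>Y. \<forall>v\<in>Y. ltY u v \<longleftrightarrow> lt (\<phi> u) (\<phi> v))"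
  unfolding induced_via_def poset_iso_def bij_betw_def by blast

lemma cosimplicial_iff:
  "cosimplicial X lt b \<longleftrightarrow>
     \<not> (\<exists>d\<in>X. \<exists>e\<in>X. d \<noteq> e \<and> incomp lt b d \<and> incomp lt b e \<and> lt d e)"
  unfolding cosimplicial_def antichain_def pairwise_def Inc_def
  by (auto simp: incomp_def[of lt d e for d e])

lemma label_UNIV: "(UNIV :: label set) = {La, Lb, Lc, Ld, Le, Lx}"
  using label.exhaust by auto

locale weighted_interval_order =
  fixes X :: "'a set" and lt :: "'a \<Rightarrow> 'a \<Rightarrow> bool" and f :: "'a \<Rightarrow> real"
  assumes interval_order: "interval_order X lt"
    and f_eq: "\<forall>x\<in>X. f x = (if cosimplicial X lt x then 0 else 1)"
begin

lemma finite_X: "finite X"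
  and irrefl: "a \<in> X \<Longrightarrow> \<not> lt a a"
  and transp_lt: "transp_on X lt"
  using interval_order by (simp_all add: interval_order_def finite_poset_def irreflp_on_def)

lemma trans: "lt a b \<Longrightarrow> lt b c \<Longrightarrow> a \<in> X \<Longrightarrow> b \<in> X \<Longrightarrow> c \<in> X \<Longrightarrow> lt a c"
  using transp_onD[OF transp_lt] by blast

lemma asym: "lt a b \<Longrightarrow> a \<in> X \<Longrightarrow> b \<in> X \<Longrightarrow> \<not> lt b a"
  using irrefl trans[of a b a] by blast

lemmas two_plus_two_free = interval_order_two_plus_two_free[OF interval_order]

lemma f_nonneg: "x \<in> X \<Longrightarrow> 0 \<le> f x"
  using f_eq by simp

definition middles_cosimplicial :: bool where
  "middles_cosimplicial \<longleftrightarrow> (\<forall>a\<in>X. \<forall>b\<in>X. \<forall>c\<in>X. \<forall>x\<in>X. lt a b \<longrightarrow> lt b c \<longrightarrow>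
     incomp lt x a \<longrightarrow> incomp lt x b \<longrightarrow> incomp lt x c \<longrightarrow> cosimplicial X lt b)"

lemma middles_cosimplicial_iff_three_plus_one:
  "middles_cosimplicial \<longleftrightarrow>
     (\<forall>\<phi>. induced_via \<phi> three_plus_one_points three_plus_one_less X lt \<longrightarrow>
          cosimplicial X lt (\<phi> Lb))"
proof
  assume m: middles_cosimplicial
  show "\<forall>\<phi>. induced_via \<phi> three_plus_one_points three_plus_one_less X lt \<longrightarrow>
          cosimplicial X lt (\<phi> Lb)"
  proof (intro allI impI)
    fix \<phi> assume "induced_via \<phi> three_plus_one_points three_plus_one_less X lt"
    then show "cosimplicial X lt (\<phi> Lb)"
      using m[unfolded middles_cosimplicial_def, rule_format, of "\<phi> La" "\<phi> Lb" "\<phi> Lc" "\<phi> Lx"]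
      by (auto simp: induced_via_iff three_plus_one_points_def three_plus_one_less_def incomp_def)
  qed
next
  assume r: "\<forall>\<phi>. induced_via \<phi> three_plus_one_points three_plus_one_less X lt \<longrightarrow>
          cosimplicial X lt (\<phi> Lb)"
  show middles_cosimplicial
    unfolding middles_cosimplicial_def
  proof (intro ballI impI)
    fix a b c x
    assume X: "a \<in> X" "b \<in> X" "c \<in> X" "x \<in> X"
      and o: "lt a b" "lt b c" "incomp lt x a" "incomp lt x b" "incomp lt x c"
    define \<phi> where "\<phi> = (\<lambda>_. x)(La := a, Lb := b, Lc := c)"
    have ac: "lt a c" using trans X o by blast
    have n: "\<not> lt b a" "\<not> lt c b" "\<not> lt c a" using asym X o ac by blast+
    have ne: "a \<noteq> b" "b \<noteq> c" "a \<noteq> c" using irrefl X o ac by auto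
    have "induced_via \<phi> three_plus_one_points three_plus_one_less X lt"
      using X o ac n ne irrefl
      by (auto simp: \<phi>_def induced_via_iff three_plus_one_points_def three_plus_one_less_def
          incomp_def)
    then show "cosimplicial X lt b" using r by (auto simp: \<phi>_def)
  qed
qed

text \<open>A non-co-simplicial middle \<open>b\<close> has points \<open>d \<prec> e\<close> in \<open>Inc(b)\<close>. Comparing \<open>d \<prec> e\<close> with \<open>a \<prec> b\<close> and
  \<open>b \<prec> c\<close>, absence of \<open>2+2\<close> gives \<open>a \<prec> e\<close> and \<open>d \<prec> c\<close>; similarly a comparability between \<open>x\<close> and \<open>d\<close>
  or \<open>e\<close> would force one between \<open>x\<close> and the chain, or between \<open>b\<close> and \<open>d\<close> or \<open>e\<close>. Only \<open>a \<prec> d\<close> and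
  \<open>e \<prec> c\<close> stay open.\<close>

lemma middles_cosimplicial_iff_H_free:
  "middles_cosimplicial \<longleftrightarrow> \<not> (\<exists>(Y, ltY)\<in>H_posets. induced_in Y ltY X lt)"
proof
  assume m: middles_cosimplicial
  show "\<not> (\<exists>(Y, ltY)\<in>H_posets. induced_in Y ltY X lt)"
  proof
    assume "\<exists>(Y, ltY)\<in>H_posets. induced_in Y ltY X lt"
    then obtain p q \<phi> where v: "induced_via \<phi> UNIV (H_less p q) X lt"
      by (auto simp: H_posets_def induced_in_def)
    then have X: "\<phi> u \<in> X" and l: "lt (\<phi> u) (\<phi> v) \<longleftrightarrow> H_less p q u v"
      and i: "\<phi> u = \<phi> v \<longleftrightarrow> u = v" for u v
      by (auto simp: induced_via_iff inj_def)
    have "cosimplicial X lt (\<phi> Lb)"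
      using m[unfolded middles_cosimplicial_def, rule_format, of "\<phi> La" "\<phi> Lb" "\<phi> Lc" "\<phi> Lx"] X
      by (simp add: l incomp_def i H_less_def)
    moreover have "\<not> cosimplicial X lt (\<phi> Lb)"
      unfolding cosimplicial_iff not_not
      by (rule bexI[OF _ X[of Ld]], rule bexI[OF _ X[of Le]])
         (simp add: l incomp_def i H_less_def)
    ultimately show False by simp
  qed
next
  assume H: "\<not> (\<exists>(Y, ltY)\<in>H_posets. induced_in Y ltY X lt)"
  show middles_cosimplicial
    unfolding middles_cosimplicial_def
  proof (intro ballI impI, rule ccontr)
    fix a b c x
    assume X: "a \<in> X" "b \<in> X" "c \<in> X" "x \<in> X"
      and o: "lt a b" "lt b c" and x: "incomp lt x a" "incomp lt x b" "incomp lt x c"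
      and "\<not> cosimplicial X lt b"
    then obtain d e where Y: "d \<in> X" "e \<in> X" and "d \<noteq> e" and b: "incomp lt b d" "incomp lt b e"
      and de: "lt d e"
      by (auto simp: cosimplicial_iff)
    have ac: "lt a c" using trans X o by blast
    have ae: "lt a e" using two_plus_two_free[of a b d e] X Y o de b by (auto simp: incomp_def)
    have dc: "lt d c" using two_plus_two_free[of d e b c] X Y o de b by (auto simp: incomp_def)
    have nda: "\<not> lt d a" using trans[of d a b] X Y o b by (auto simp: incomp_def)
    have nce: "\<not> lt c e" using trans[of b c e] X Y o b by (auto simp: incomp_def)
    have xd: "incomp lt x d"
      using trans[of x d c] two_plus_two_free[of d x a b] X Y o b x dc
      by (auto simp: incomp_def)
    have xe: "incomp lt x e"
      using trans[of a e x] two_plus_two_free[of x e b c] X Y o b x ae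
      by (auto simp: incomp_def)
    define p q where "p = lt a d" and "q = lt e c"
    define \<phi> where "\<phi> = (\<lambda>_. x)(La := a, Lb := b, Lc := c, Ld := d, Le := e)"
    have n: "\<not> lt b a" "\<not> lt c b" "\<not> lt c a" "\<not> lt e d" "\<not> lt e a" "\<not> lt c d"
      using asym X Y o ac de ae dc by blast+
    have r: "\<not> lt a a" "\<not> lt b b" "\<not> lt c c" "\<not> lt d d" "\<not> lt e e" "\<not> lt x x"
      using irrefl X Y by auto
    have ne: "a \<noteq> b" "b \<noteq> c" "a \<noteq> c" "d \<noteq> e" "a \<noteq> e" "d \<noteq> c" "a \<noteq> d" "c \<noteq> e"
      using n o ac de ae dc b r by (auto simp: incomp_def)
    have "inj_on \<phi> UNIV" "\<phi> ` UNIV \<subseteq> X"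
      using X Y ne b x xd xe by (auto simp: label_UNIV \<phi>_def incomp_def)
    moreover have "\<forall>u v. H_less p q u v \<longleftrightarrow> lt (\<phi> u) (\<phi> v)"
    proof (intro allI)
      fix u v show "H_less p q u v \<longleftrightarrow> lt (\<phi> u) (\<phi> v)"
        using o ac de ae dc n r b x xd xe nda nce
        by (cases u; cases v) (auto simp: H_less_def \<phi>_def p_def q_def incomp_def)
    qed
    ultimately have "induced_in UNIV (H_less p q) X lt"
      unfolding induced_in_def induced_via_iff by blast
    then show False using H by (auto simp: H_posets_def)
  qed
qed

text \<open>The interval of the middle element \<open>b\<close> lies strictly between points of \<open>I\<^sub>a\<close> and of \<open>I\<^sub>c\<close> that belong to
  \<open>I\<^sub>x\<close>, hence is shorter than \<open>I\<^sub>x\<close> and must be a point. All intervals of points in \<open>Inc(b)\<close> share that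
  point, so they are pairwise intersecting.\<close>

lemma zero_one_interval_rep_middles_cosimplicial:
  assumes "zero_one_interval_rep X lt I"
  shows middles_cosimplicial
  unfolding middles_cosimplicial_def
proof (intro ballI impI)
  fix a b c x
  assume X: "a \<in> X" "b \<in> X" "c \<in> X" "x \<in> X"
    and o: "lt a b" "lt b c" and x: "incomp lt x a" "incomp lt x b" "incomp lt x c"
  have l: "lt u v \<longleftrightarrow> upper (I u) < lower (I v)" if "u \<in> X" "v \<in> X" for u v
    using assms that by (simp add: zero_one_interval_rep_def interval_rep_def left_of_iff)
  have w: "upper (I u) - lower (I u) = 0 \<or> upper (I u) - lower (I u) = 1" if "u \<in> X" for u
    using assms that by (simp add: zero_one_interval_rep_def width_def)
  have "lower (I x) \<le> upper (I a)" "lower (I c) \<le> upper (I x)"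
    using x X l by (auto simp: incomp_def)
  then have "upper (I b) - lower (I b) < upper (I x) - lower (I x)"
    using o X l by fastforce
  then have eq: "upper (I b) = lower (I b)"
    using w[of b] w[of x] X by linarith
  show "cosimplicial X lt b"
    unfolding cosimplicial_iff using X eq l by (fastforce simp: incomp_def)
qed


section \<open>Minimal nonpositive closed walks\<close>

abbreviation W :: "'a \<Rightarrow> 'a \<Rightarrow> real" where
  "W a b \<equiv> weight (G' X lt f) (a, b)"

lemma W_eq: "W a b = (if lt b a then - f b else f a)"
  by (simp add: G'_def)

lemma arcs_G': "(a, b) \<in> arcs (G' X lt f) \<longleftrightarrow> a \<in> X \<and> b \<in> X \<and> (lt b a \<or> incomp lt a b)"
  by (auto simp: arcs_def G'_def)

lemma minus_arcs_G': "(a, b) \<in> minus_arcs (G' X lt f) \<longleftrightarrow> a \<in> X \<and> b \<in> X \<and> lt b a"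
  by (simp add: G'_def)

definition nonpositive_walk :: "'a list \<Rightarrow> bool" where
  "nonpositive_walk xs \<longleftrightarrow> closed_walk (G' X lt f) xs \<and> (\<exists>(a, b)\<in>set (cycle_arcs xs). lt b a)
     \<and> cycle_weight (G' X lt f) xs \<le> 0"

definition minimal_nonpositive_walk :: "'a list \<Rightarrow> bool" where
  "minimal_nonpositive_walk xs \<longleftrightarrow> nonpositive_walk xs \<and>
     (\<forall>ys. length ys < length xs \<longrightarrow> \<not> nonpositive_walk ys)"

lemma minimal_nonpositive_walk_rotate:
  "minimal_nonpositive_walk xs \<Longrightarrow> minimal_nonpositive_walk (rotate k xs)"
  by (simp add: minimal_nonpositive_walk_def nonpositive_walk_def closed_walk_rotate set_cycle_arcs_rotate
      cycle_weight_rotate)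

text \<open>The weights \<open>- f c\<close> and \<open>f c\<close> of the turn \<open>b, c, d\<close> cancel, so minimality forbids an arc \<open>(b, d)\<close> of weight
  at most 0. If \<open>d \<prec> b\<close> that arc has weight \<open>- f d\<close>; if \<open>b \<parallel> d\<close> and \<open>f b = 0\<close> it has weight 0. Once
  \<open>b \<parallel> d\<close> is known, \<open>Inc(d)\<close> contains the comparable points \<open>b\<close> and \<open>c\<close>, which gives \<open>f d = 1\<close>.\<close>

lemma turn_incomparable:
  assumes min: "minimal_nonpositive_walk (b # c # d # r)" and cb: "lt c b" and cd: "incomp lt c d"
  shows "incomp lt b d" "f b = 1" "f d = 1"
proof -
  let ?D = "G' X lt f" and ?z = "zip (d # r) (r @ [b])"
  have old: "cycle_arcs (b # c # d # r) = (b, c) # (c, d) # ?z"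
    and new: "cycle_arcs (b # d # r) = (b, d) # ?z"
    by (simp_all add: cycle_arcs_Cons)
  have bad: "nonpositive_walk (b # c # d # r)" and notbad: "\<not> nonpositive_walk (b # d # r)"
    using min by (auto simp: minimal_nonpositive_walk_def)
  have arcs: "set ?z \<subseteq> arcs ?D" and X: "b \<in> X" "c \<in> X" "d \<in> X"
    using bad unfolding nonpositive_walk_def closed_walk_def old by (auto simp: arcs_G')
  have "W b c + W c d + (\<Sum>e\<leftarrow>?z. weight ?D e) \<le> 0"
    using bad unfolding nonpositive_walk_def cycle_weight_def old by simp
  then have rest: "(\<Sum>e\<leftarrow>?z. weight ?D e) \<le> 0"
    using cb cd by (simp add: W_eq incomp_def)
  have "\<not> lt d b"
  proof
    assume db: "lt d b"
    then have "nonpositive_walk (b # d # r)"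
      unfolding nonpositive_walk_def closed_walk_def cycle_weight_def new
      using arcs X rest f_nonneg[of d] by (auto simp: arcs_G' W_eq)
    then show False using notbad by simp
  qed
  then show inc: "incomp lt b d"
    using trans[of c b d] X cb cd by (auto simp: incomp_def)
  have "\<not> cosimplicial X lt d"
    unfolding cosimplicial_iff not_not
    using X cb cd inc irrefl by (intro bexI[of _ c] bexI[of _ b]) (auto simp: incomp_def)
  then show fd: "f d = 1" using f_eq X by simp
  have "f b \<noteq> 0"
  proof
    assume fb: "f b = 0"
    \<comment> \<open>The shortcut removes the \<open>(-)\<close> arc \<open>(b, c)\<close>, so another one must be found: with \<open>(+)\<close> arcs only,
      the arc leaving \<open>d\<close> would already make the remaining weight at least \<open>f d = 1\<close>.\<close>
    have "\<exists>(u, v)\<in>set ?z. lt v u"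
    proof (rule ccontr)
      assume no: "\<not> (\<exists>(u, v)\<in>set ?z. lt v u)"
      obtain h t where ht: "r @ [b] = h # t" by (cases "r @ [b]") auto
      have nn: "\<forall>e\<in>set ?z. 0 \<le> weight ?D e"
      proof
        fix e assume "e \<in> set ?z"
        moreover obtain u v where "e = (u, v)" by force
        ultimately have "\<not> lt v u" "u \<in> X" "e = (u, v)" using no arcs arcs_G' by blast+
        then show "0 \<le> weight ?D e" using f_nonneg by (simp add: W_eq)
      qed
      have z: "?z = (d, h) # zip r t" using ht by simp
      have "W d h = 1" using no fd unfolding z by (simp add: W_eq)
      moreover have "0 \<le> (\<Sum>e\<leftarrow>zip r t. weight ?D e)"
        using nn unfolding z by (intro sum_list_nonneg) auto
      ultimately show False using rest unfolding z by simp
    qed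
    then have "nonpositive_walk (b # d # r)"
      unfolding nonpositive_walk_def closed_walk_def cycle_weight_def new
      using arcs X rest inc fb by (auto simp: arcs_G' W_eq incomp_def)
    then show False using notbad by simp
  qed
  then show "f b = 1" using f_eq X by (simp split: if_splits)
qed

text \<open>If the vertex \<open>e\<close> after the turn satisfies \<open>e \<prec> d\<close>, then \<open>c \<prec> b\<close>, \<open>e \<prec> d\<close> and \<open>c \<parallel> d\<close> give \<open>e \<prec> b\<close>, and
  the single arc \<open>(b, e)\<close> has the same weight \<open>- f e\<close> as the three arcs that it replaces. When \<open>r\<close> is
  empty the next vertex is \<open>b\<close> itself, whence the form \<open>hd (r @ [b])\<close>.\<close>

lemma turn_next:
  assumes min: "minimal_nonpositive_walk (b # c # d # r)" and cb: "lt c b" and cd: "incomp lt c d"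
  shows "\<not> lt (hd (r @ [b])) d"
proof
  let ?D = "G' X lt f"
  assume l: "lt (hd (r @ [b])) d"
  have inc: "incomp lt b d" by (rule turn_incomparable[OF min cb cd])
  obtain e r' where r: "r = e # r'"
    using l inc by (cases r) (auto simp: incomp_def)
  let ?z = "zip (e # r') (r' @ [b])"
  have old: "cycle_arcs (b # c # d # r) = (b, c) # (c, d) # (d, e) # ?z"
    and new: "cycle_arcs (b # e # r') = (b, e) # ?z"
    by (simp_all add: cycle_arcs_Cons r)
  have bad: "nonpositive_walk (b # c # d # r)" and notbad: "\<not> nonpositive_walk (b # e # r')"
    using min by (auto simp: minimal_nonpositive_walk_def r)
  have arcs: "set ?z \<subseteq> arcs ?D" and X: "b \<in> X" "c \<in> X" "d \<in> X" "e \<in> X"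
    using bad unfolding nonpositive_walk_def closed_walk_def old by (auto simp: arcs_G')
  have ed: "lt e d" using l r by simp
  have "W b c + W c d + W d e + (\<Sum>e\<leftarrow>?z. weight ?D e) \<le> 0"
    using bad unfolding nonpositive_walk_def cycle_weight_def old by simp
  then have rest: "- f e + (\<Sum>e\<leftarrow>?z. weight ?D e) \<le> 0"
    using cb cd ed by (simp add: W_eq incomp_def)
  have "lt e b"
    using two_plus_two_free[of c b e d] X cb cd ed by (auto simp: incomp_def)
  then have "nonpositive_walk (b # e # r')"
    unfolding nonpositive_walk_def closed_walk_def cycle_weight_def new
    using arcs X rest by (auto simp: arcs_G' W_eq)
  then show False using notbad by simp
qed

text \<open>If the vertex \<open>a\<close> before the turn satisfies \<open>b \<prec> a\<close>, then either \<open>d \<prec> a\<close>, and the arc \<open>(a, d)\<close> replaces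
  three arcs of the same total weight \<open>- 1\<close>, or \<open>d\<close> is incomparable to the whole chain \<open>c \<prec> b \<prec> a\<close>, whose
  middle \<open>b\<close> is not co-simplicial because \<open>f b = 1\<close>.\<close>

lemma turn_prev:
  assumes mid: middles_cosimplicial
    and min: "minimal_nonpositive_walk (b # c # d # r)" and cb: "lt c b" and cd: "incomp lt c d"
  shows "\<not> lt b (last (d # r))"
proof
  let ?D = "G' X lt f"
  assume l: "lt b (last (d # r))"
  have inc: "incomp lt b d" and f: "f b = 1" "f d = 1"
    by (rule turn_incomparable[OF min cb cd])+
  obtain a r' where r: "r = r' @ [a]"
    using l inc by (cases r rule: rev_cases) (auto simp: incomp_def)
  let ?z = "zip (d # r') (r' @ [a])"
  have old: "cycle_arcs (b # c # d # r) = (b, c) # (c, d) # ?z @ [(a, b)]"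
    and new: "cycle_arcs (d # r) = ?z @ [(a, d)]"
    using zip_append[of "d # r'" "r' @ [a]" "[a]"] by (simp_all add: cycle_arcs_Cons r)
  have bad: "nonpositive_walk (b # c # d # r)" and notbad: "\<not> nonpositive_walk (d # r)"
    using min by (auto simp: minimal_nonpositive_walk_def)
  have arcs: "set ?z \<subseteq> arcs ?D" and X: "b \<in> X" "c \<in> X" "d \<in> X" "a \<in> X"
    using bad unfolding nonpositive_walk_def closed_walk_def old by (auto simp: arcs_G')
  have ba: "lt b a" using l r by simp
  have "W b c + W c d + (\<Sum>e\<leftarrow>?z. weight ?D e) + W a b \<le> 0"
    using bad unfolding nonpositive_walk_def cycle_weight_def old by simp
  then have rest: "- f b + (\<Sum>e\<leftarrow>?z. weight ?D e) \<le> 0"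
    using cb cd ba by (simp add: W_eq incomp_def)
  have "lt d a"
  proof (rule ccontr)
    assume "\<not> lt d a"
    moreover have "lt c a" using trans X cb ba by blast
    ultimately have "incomp lt d a"
      using trans[of c a d] X cd inc ba by (auto simp: incomp_def)
    then have "cosimplicial X lt b"
      using mid X cb ba cd inc unfolding middles_cosimplicial_def incomp_def by metis
    then show False using f_eq X f by simp
  qed
  then have "nonpositive_walk (d # r)"
    unfolding nonpositive_walk_def closed_walk_def cycle_weight_def new
    using arcs X rest f by (auto simp: arcs_G' W_eq)
  then show False using notbad by simp
qed

text \<open>The walk is unrolled to a periodic sequence \<open>x\<close>, with \<open>m i\<close> for its \<open>i\<close>-th arc being a \<open>(-)\<close> arc. Two
  consecutive \<open>(-)\<close> arcs would be followed by a third one (there is no \<open>(-)\<close> arc before a turn), and so on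
  for ever, against irreflexivity. With \<open>(-)\<close> arcs isolated, the weight collected by vertices has
  only nonnegative terms and a term 1 behind each turn.\<close>

lemma no_minimal_nonpositive_walk:
  assumes mid: middles_cosimplicial and min: "minimal_nonpositive_walk xs"
  shows False
proof -
  let ?D = "G' X lt f"
  define n where "n = length xs"
  define x where "x i = xs ! (i mod n)" for i
  define m where "m i \<longleftrightarrow> lt (x (Suc i)) (x i)" for i
  have bad: "nonpositive_walk xs" using min by (simp add: minimal_nonpositive_walk_def)
  then have n0: "n > 0" by (auto simp: nonpositive_walk_def closed_walk_def n_def)
  have per: "x (i + n) = x i" for i by (simp add: x_def)
  have arc: "(x i, x (Suc i)) \<in> arcs ?D" for i
  proof -
    have "cycle_arcs xs ! (i mod n) = (x i, x (Suc i))"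
      using n0 by (simp add: nth_cycle_arcs n_def x_def mod_Suc_eq)
    moreover have "cycle_arcs xs ! (i mod n) \<in> set (cycle_arcs xs)"
      using n0 by (intro nth_mem) (simp add: n_def)
    ultimately show ?thesis using bad by (auto simp: nonpositive_walk_def closed_walk_def)
  qed
  have X: "x i \<in> X" for i using arc[of i] by (simp add: arcs_G')
  have plus: "incomp lt (x i) (x (Suc i))" if "\<not> m i" for i
    using arc[of i] that by (simp add: arcs_G' m_def)
  have not_all: "\<not> (\<forall>k. m (i + k))" for i
  proof
    assume all: "\<forall>k. m (i + k)"
    have "lt (x (i + Suc k)) (x i)" for k
    proof (induction k)
      case 0 then show ?case using all[rule_format, of 0] by (simp add: m_def)
    next
      case (Suc k)
      then show ?case using all[rule_format, of "Suc k"] trans X by (auto simp: m_def)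
    qed
    from this[of "n - 1"] show False using n0 per irrefl X by simp
  qed
  \<comment> \<open>The index \<open>i + (n - 1)\<close> stands for the predecessor of \<open>i\<close>, which is not available at \<open>i = 0\<close>.\<close>
  have turn: "f (x (i + 2)) = 1 \<and> \<not> m (i + 2) \<and> \<not> lt (x i) (x (i + (n - 1)))"
    if mi: "m i" and ni: "\<not> m (Suc i)" for i
  proof -
    have cb: "lt (x (Suc i)) (x i)" using mi by (simp add: m_def)
    have cd: "incomp lt (x (Suc i)) (x (i + 2))" using plus[OF ni] by simp
    have "n \<noteq> 1" using cb irrefl X per[of i] by auto
    moreover have "n \<noteq> 2" using cb cd per[of i] by (auto simp: incomp_def)
    ultimately have n3: "n \<ge> 3" using n0 by linarith
    have nth: "rotate i xs ! k = x (i + k)" if "k < n" for k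
      using that by (simp add: nth_rotate x_def n_def)
    have len: "length (rotate i xs) = n" by (simp add: n_def)
    then obtain b c d r where rot: "rotate i xs = b # c # d # r"
      using n3 by (metis Suc_le_length_iff numeral_3_eq_3)
    have b: "b = x i" using nth[of 0] n3 rot by simp
    have c: "c = x (Suc i)" using nth[of 1] n3 rot by simp
    have d: "d = x (i + 2)" using nth[of 2] n3 rot by simp
    have la: "last (d # r) = x (i + (n - 1))"
      using nth[of "n - 1"] n3 rot len by (metis Suc_1 diff_less last.simps last_conv_nth
        list.distinct(1) n0 zero_less_one)
    have he: "hd (r @ [b]) = x (i + 3)"
    proof (cases r)
      case Nil
      then have "n = 3" using rot len by simp
      then show ?thesis using Nil b per[of i] by simp
    next
      case (Cons e r')
      then show ?thesis using rot len nth[of 3] by simp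
    qed
    note M = minimal_nonpositive_walk_rotate[OF min, of i, unfolded rot]
    have "lt c b" "incomp lt c d" using b c d cb cd by simp_all
    from turn_incomparable(3)[OF M this] turn_next[OF M this] turn_prev[OF mid M this]
    show ?thesis using b d la he by (simp add: m_def eval_nat_numeral)
  qed
  have no_mm: "\<not> m (Suc i)" if "m i" for i
  proof
    assume "m (Suc i)"
    have "m (i + k) \<and> m (Suc (i + k))" for k
    proof (induction k)
      case 0 show ?case using \<open>m i\<close> \<open>m (Suc i)\<close> by simp
    next
      case (Suc k)
      have "Suc (i + k) + (n - 1) = i + k + n" using n0 by simp
      then have "x (Suc (i + k) + (n - 1)) = x (i + k)" using per by metis
      then have "m (Suc (Suc (i + k)))"
        using turn[of "Suc (i + k)"] Suc by (auto simp: m_def)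
      then show ?case using Suc by simp
    qed
    then show False using not_all[of i] by blast
  qed
  \<comment> \<open>The positive part \<open>P i\<close> belongs to the tail of the \<open>i\<close>-th arc, the negative part \<open>M i\<close> to its head.
    Shifting the index of \<open>P\<close> brings the two contributions of each vertex together.\<close>
  define P M where "P i = (if m i then 0 else f (x i))"
    and "M i = (if m i then f (x (Suc i)) else 0)" for i
  have "cycle_weight ?D xs = (\<Sum>i<n. W (x i) (x (Suc i)))"
    unfolding cycle_weight_sum by (simp add: n_def x_def mod_Suc_eq)
  also have "\<dots> = (\<Sum>i<n. P i) - (\<Sum>i<n. M i)"
    unfolding sum_subtractf[symmetric] by (intro sum.cong) (auto simp: W_eq P_def M_def m_def)
  also have "(\<Sum>i<n. P i) = (\<Sum>i<n. P (Suc i))"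
    by (rule sum_periodic_shift[symmetric]) (use per[of 0] per[of 1] in \<open>simp add: P_def m_def\<close>)
  also have "\<dots> - (\<Sum>i<n. M i) = (\<Sum>i<n. P (Suc i) - M i)"
    by (simp add: sum_subtractf)
  finally have wt: "cycle_weight ?D xs = (\<Sum>i<n. P (Suc i) - M i)" .
  have nn: "0 \<le> P (Suc i) - M i" for i
    using no_mm[of i] f_nonneg[OF X] by (simp add: P_def M_def)
  obtain j where "j < n" "m j"
    using bad unfolding nonpositive_walk_def in_set_conv_nth
    by (auto simp: nth_cycle_arcs n_def m_def x_def in_set_conv_nth)
  have "\<not> m (Suc j)" using no_mm \<open>m j\<close> by blast
  with turn[OF \<open>m j\<close>] have pos: "P (Suc (Suc j)) - M (Suc j) = 1"
    by (simp add: P_def M_def)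
  have "P (Suc (Suc j mod n)) - M (Suc j mod n) = P (Suc (Suc j)) - M (Suc j)"
    by (simp add: P_def M_def m_def x_def mod_Suc_eq mod_Suc_Suc_eq)
  then have "0 < (\<Sum>i<n. P (Suc i) - M i)"
    using nn n0 pos by (intro sum_pos2[of _ "Suc j mod n"]) auto
  then show False using wt bad by (simp add: nonpositive_walk_def)
qed

theorem closed_walk_positive:
  assumes middles_cosimplicial and cw: "closed_walk (G' X lt f) xs"
    and "\<exists>e\<in>set (cycle_arcs xs). e \<in> minus_arcs (G' X lt f)"
  shows "0 < cycle_weight (G' X lt f) xs"
proof (rule ccontr)
  assume "\<not> ?thesis"
  moreover obtain a b where "(a, b) \<in> set (cycle_arcs xs)" "lt b a"
    using assms(3) by (auto simp: minus_arcs_G')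
  ultimately have "nonpositive_walk xs" using cw unfolding nonpositive_walk_def by auto
  then obtain ys where "nonpositive_walk ys" "\<forall>zs. nonpositive_walk zs \<longrightarrow> length ys \<le> length zs"
    using ex_has_least_nat[of nonpositive_walk xs length] by blast
  then have "minimal_nonpositive_walk ys" by (auto simp: minimal_nonpositive_walk_def not_less[symmetric])
  then show False using no_minimal_nonpositive_walk assms(1) by blast
qed


section \<open>The weighted digraphs\<close>

lemma arcs_G: "arcs (G \<epsilon> X lt f) = arcs (G' X lt f)"
  by (simp add: G_def G'_def arcs_def)

lemma is_cycle_G: "is_cycle (G \<epsilon> X lt f) xs \<longleftrightarrow> is_cycle (G' X lt f) xs"
  unfolding is_cycle_def arcs_G by (simp add: G_def G'_def)

lemma cycle_weight_G:
  "cycle_weight (G \<epsilon> X lt f) xs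
     = cycle_weight (G' X lt f) xs - \<epsilon> * length (filter (\<lambda>(a, b). lt b a) (cycle_arcs xs))"
proof -
  have "(\<Sum>e\<leftarrow>es. weight (G \<epsilon> X lt f) e)
      = (\<Sum>e\<leftarrow>es. weight (G' X lt f) e) - \<epsilon> * length (filter (\<lambda>(a, b). lt b a) es)" for es
    by (induction es) (auto simp: G_def G'_def algebra_simps)
  then show ?thesis by (simp add: cycle_weight_def)
qed

lemma cycle_weight_G'_Ints:
  assumes "closed_walk (G' X lt f) xs"
  shows "cycle_weight (G' X lt f) xs \<in> \<int>"
proof -
  have f: "f v \<in> \<int>" if "v \<in> X" for v using f_eq that by simp
  have "weight (G' X lt f) e \<in> \<int>" if "e \<in> set (cycle_arcs xs)" for e
  proof -
    obtain a b where e: "e = (a, b)" by force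
    then have "a \<in> X" "b \<in> X" using assms that arcs_G' unfolding closed_walk_def by blast+
    then show ?thesis using f by (simp add: e W_eq)
  qed
  moreover have "(\<forall>e\<in>set es. w e \<in> \<int>) \<Longrightarrow> (\<Sum>e\<leftarrow>es. w e) \<in> \<int>" for es and w :: "'a \<times> 'a \<Rightarrow> real"
    by (induction es) auto
  ultimately show ?thesis unfolding cycle_weight_def by blast
qed

text \<open>A cycle has at most \<open>|X|\<close> arcs, so its weights in the two digraphs differ by less than 1, while
  positive weight in \<open>G'\<close> is at least 1 by integrality. Without \<open>(-)\<close> arcs the weights agree and are sums of
  values of \<open>f\<close>.\<close>

lemma no_negative_cycle_G:
  assumes eps: "0 < \<epsilon>" "\<epsilon> * (real (card X))\<^sup>2 < 1"
    and pos: "\<And>xs. is_cycle (G' X lt f) xs \<Longrightarrow>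
      \<exists>e\<in>set (cycle_arcs xs). e \<in> minus_arcs (G' X lt f) \<Longrightarrow> 0 < cycle_weight (G' X lt f) xs"
  shows "\<not> negative_cycle (G \<epsilon> X lt f) xs"
proof
  assume neg: "negative_cycle (G \<epsilon> X lt f) xs"
  then have cyc: "is_cycle (G' X lt f) xs" by (simp add: negative_cycle_def is_cycle_G)
  then have cw: "closed_walk (G' X lt f) xs" by (simp add: is_cycle_def closed_walk_def)
  let ?w = "cycle_weight (G' X lt f) xs"
  define k where "k = length (filter (\<lambda>(a, b). lt b a) (cycle_arcs xs))"
  have lt0: "?w - \<epsilon> * k < 0"
    using neg unfolding negative_cycle_def cycle_weight_G k_def by simp
  show False
  proof (cases "\<exists>e\<in>set (cycle_arcs xs). e \<in> minus_arcs (G' X lt f)")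
    case True
    then have "0 < ?w" using pos cyc by blast
    then have "1 \<le> ?w" using cycle_weight_G'_Ints[OF cw] by (auto elim!: Ints_cases)
    have "length xs = card (set xs)" using cyc by (simp add: is_cycle_def distinct_card)
    also have "\<dots> \<le> card X"
      using cyc finite_X by (intro card_mono) (auto simp: is_cycle_def G'_def)
    finally have "length xs \<le> card X" .
    moreover have "k \<le> length xs" unfolding k_def by (metis length_cycle_arcs length_filter_le)
    ultimately have "k \<le> (card X)\<^sup>2"
      by (metis le_trans power2_nat_le_imp_le le_refl power2_eq_square le_square)
    then have "real k \<le> (real (card X))\<^sup>2"
      by (metis of_nat_le_iff of_nat_power)
    then have "\<epsilon> * k \<le> \<epsilon> * (real (card X))\<^sup>2" using eps(1) by simp
    then show False using lt0 eps(2) \<open>1 \<le> ?w\<close> by linarith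
  next
    case False
    have arc: "a \<in> X \<and> \<not> lt b a" if "(a, b) \<in> set (cycle_arcs xs)" for a b
      using that False cw arcs_G' minus_arcs_G' unfolding closed_walk_def by blast
    then have "k = 0" by (auto simp: k_def filter_empty_conv)
    have "0 \<le> weight (G' X lt f) e" if "e \<in> set (cycle_arcs xs)" for e
    proof -
      obtain a b where "e = (a, b)" by force
      then show ?thesis using that arc[of a b] f_nonneg by (simp add: W_eq)
    qed
    then have "0 \<le> ?w" unfolding cycle_weight_def by (intro sum_list_nonneg) auto
    then show False using lt0 \<open>k = 0\<close> by simp
  qed
qed

text \<open>A potential serves as left endpoints and \<open>f\<close> as lengths. The slack \<open>\<epsilon>\<close> makes comparable intervals
  disjoint, although closed.\<close>

lemma zero_one_interval_rep_if_no_negative_cycle: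
  assumes eps: "0 < \<epsilon>" and "\<nexists>xs. negative_cycle (G \<epsilon> X lt f) xs"
  shows "\<exists>I. zero_one_interval_rep X lt I"
proof -
  have "finite (verts (G \<epsilon> X lt f))" "arcs (G \<epsilon> X lt f) \<subseteq> verts (G \<epsilon> X lt f) \<times> verts (G \<epsilon> X lt f)"
    using finite_X by (auto simp: G_def arcs_def)
  from no_negative_cycle_potential[OF this assms(2)]
  obtain p where p: "\<forall>(a, b)\<in>arcs (G \<epsilon> X lt f). p b \<le> p a + weight (G \<epsilon> X lt f) (a, b)"
    by blast
  have minus: "p b + f b < p a" if "a \<in> X" "b \<in> X" "lt b a" for a b
  proof -
    have "p b \<le> p a + weight (G \<epsilon> X lt f) (a, b)"
      using p that by (auto simp: arcs_G arcs_G')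
    then show ?thesis using that eps by (simp add: G_def)
  qed
  have plus: "p b \<le> p a + f a" if "a \<in> X" "b \<in> X" "incomp lt a b" for a b
  proof -
    have "p b \<le> p a + weight (G \<epsilon> X lt f) (a, b)"
      using p that by (auto simp: arcs_G arcs_G')
    then show ?thesis using that by (simp add: G_def incomp_def)
  qed
  define I where "I v = Interval (p v, p v + f v)" for v
  have I: "lower (I v) = p v" "upper (I v) = p v + f v" if "v \<in> X" for v
    using f_nonneg[OF that] by (simp_all add: I_def lower.rep_eq upper.rep_eq Interval_inverse)
  have "lt a b \<longleftrightarrow> left_of (I a) (I b)" if "a \<in> X" "b \<in> X" for a b
  proof
    assume "lt a b"
    then show "left_of (I a) (I b)" using minus that by (simp add: left_of_iff I)
  next
    assume "left_of (I a) (I b)"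
    then have l: "p a + f a < p b" using that by (simp add: left_of_iff I)
    show "lt a b"
    proof (rule ccontr)
      assume "\<not> lt a b"
      moreover have "0 \<le> f a" "0 \<le> f b" using f_nonneg that by blast+
      then have "\<not> lt b a" "a \<noteq> b" using minus[of a b] l that by auto
      ultimately show False using plus[of a b] that l by (simp add: incomp_def)
    qed
  qed
  then have "zero_one_interval_rep X lt I"
    using f_eq by (simp add: zero_one_interval_rep_def interval_rep_def width_def I)
  then show ?thesis by blast
qed

end


section \<open>The equivalence\<close>

theorem theorem10:
  fixes X :: "'a set" and lt :: "'a \<Rightarrow> 'a \<Rightarrow> bool" and f :: "'a \<Rightarrow> real" and \<epsilon> :: real
  assumes "interval_order X lt"
    and "\<forall>x\<in>X. f x = (if cosimplicial X lt x then 0 else 1)"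
    and "0 < \<epsilon>" and "\<epsilon> * (real (card X))\<^sup>2 < 1"
  shows
    "((\<exists>I. zero_one_interval_rep X lt I) \<longleftrightarrow>
        (\<forall>\<phi>. induced_via \<phi> three_plus_one_points three_plus_one_less X lt \<longrightarrow>
              cosimplicial X lt (\<phi> Lb)))
     \<and> ((\<exists>I. zero_one_interval_rep X lt I) \<longleftrightarrow>
        \<not> (\<exists>xs. negative_cycle (G \<epsilon> X lt f) xs))
     \<and> ((\<exists>I. zero_one_interval_rep X lt I) \<longleftrightarrow>
        (\<forall>xs. is_cycle (G' X lt f) xs \<and> (\<exists>e\<in>set (cycle_arcs xs). e \<in> minus_arcs (G' X lt f)) \<longrightarrow>
              cycle_weight (G' X lt f) xs > 0))
     \<and> ((\<exists>I. zero_one_interval_rep X lt I) \<longleftrightarrow>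
        \<not> (\<exists>(Y, ltY)\<in>H_posets. induced_in Y ltY X lt))"
proof -
  interpret weighted_interval_order X lt f
    using assms by unfold_locales
  let ?rep = "\<exists>I. zero_one_interval_rep X lt I"
  let ?nonneg = "\<not> (\<exists>xs. negative_cycle (G \<epsilon> X lt f) xs)"
  let ?pos = "\<forall>xs. is_cycle (G' X lt f) xs
      \<and> (\<exists>e\<in>set (cycle_arcs xs). e \<in> minus_arcs (G' X lt f)) \<longrightarrow>
        cycle_weight (G' X lt f) xs > 0"
  have "?rep \<Longrightarrow> middles_cosimplicial"
    using zero_one_interval_rep_middles_cosimplicial by blast
  moreover have "middles_cosimplicial \<Longrightarrow> ?pos"
    using closed_walk_positive by (simp add: is_cycle_def closed_walk_def)
  moreover have "?pos \<Longrightarrow> ?nonneg"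
    using no_negative_cycle_G[OF assms(3,4)] by blast
  moreover have "?nonneg \<Longrightarrow> ?rep"
    using zero_one_interval_rep_if_no_negative_cycle[OF assms(3)] by blast
  ultimately have "?rep \<longleftrightarrow> middles_cosimplicial" "?rep \<longleftrightarrow> ?nonneg" "?rep \<longleftrightarrow> ?pos"
    by argo+
  then show ?thesis
    using middles_cosimplicial_iff_three_plus_one middles_cosimplicial_iff_H_free by simp
qed

end
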